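(* Let $N\subset\mathbb R^3$ be a triply periodic Steiner network with quotient graph $D_1\square D_2$, with edge lengths $x_1,\dots,x_6$, angle $\alpha\in(0,\pi)$, length $L$ and spanned volume $V$. Then $$\frac{L^3}{V}\ \ge\ \frac{81}{4},$$ where equality holds if and only if $$x_1=x_2=x_3=x_4=2x_5+2x_6\quad\text{and}\quad \alpha=\frac\pi2.$$ In the equality case the lattice is generated, up to similarity, by $(0,1,0)$, $(0,0,1)$, $\frac12(\sqrt3,1,1)$.
   Context: An ($n$-periodic) network $N$ (triply periodic if $n=3$) is a connected simple graph immersed with straight edges of positive length into $\mathbb R^n$ such that: $N$ is invariant under a lattice $\Lambda\subset\mathbb R^n$ of rank $n$, and the quotient $N/\Lambda$ is a finite graph, possibly with loops and multiple edges. "Immersed" means that for each vertex the restriction of the map to the union of the incident edges is injective. The length is $L=L(N/\Lambda)$, the total edge length of the quotient, and the (spanned) volume is $V=V(\mathbb R^n/\Lambda)$. A Steiner network is a network all of whose vertices have degree $3$, such that at each vertex the three unit edge vectors sum to zero (edges are coplanar and meet at $120^\circ$). $D_1\square D_2$ is the $3$-regular multigraph with four vertices $A,B,C,D$ and six edges: $e_1,e_2$ both joining $A$ and $B$; $e_3,e_4$ both joining $C$ and $D$; $e_5$ joining $A$ and $C$; $e_6$ joining $B$ and $D$. The length of $e_i$ is $x_i>0$. The angle $\alpha$: take lifts $p_1$ of $A$ and $p_2$ of $C$ joined by a lift of $e_5$; let $p_0$ be the endpoint (a lift of $B$) of the lift of $e_1$ at $p_1$, and $p_3$ the endpoint (a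 lift of $D$) of the lift of $e_3$ at $p_2$. Then $\alpha$ is the angle between the components of $p_1-p_0$ and of $p_3-p_2$ orthogonal to $p_2-p_1$. For a triply periodic Steiner network with this quotient, $\alpha\in(0,\pi)$. (Equivalently, the edges of $N$ lie in two families of parallel planes making the angle $\alpha$.) *)

theory Defs
  imports "HOL-Analysis.Analysis"
begin

section \<open>Lattices\<close>

definition int_span :: "(real^'n) set \<Rightarrow> (real^'n) set" where
  "int_span B = {(\<Sum>b\<in>B. of_int (k b) *\<^sub>R b) | k :: real^'n \<Rightarrow> int. True}"

definition lattice_basis :: "(real^'n) set \<Rightarrow> (real^'n) set \<Rightarrow> bool" where
  "lattice_basis B \<Lambda> \<longleftrightarrow> independent B \<and> span B = UNIV \<and> \<Lambda> = int_span B"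

definition full_rank_lattice :: "(real^'n) set \<Rightarrow> bool" where
  "full_rank_lattice \<Lambda> \<longleftrightarrow> (\<exists>B. lattice_basis B \<Lambda>)"

definition fundamental_parallelepiped :: "(real^'n) set \<Rightarrow> (real^'n) set" where
  "fundamental_parallelepiped B =
     {(\<Sum>b\<in>B. t b *\<^sub>R b) | t :: real^'n \<Rightarrow> real. \<forall>b\<in>B. 0 \<le> t b \<and> t b < 1}"

text \<open>The volume of the torus \<open>\<real>\<^sup>n / \<Lambda>\<close>. The value does not depend on the chosen
  basis, since any two bases of a lattice differ by a unimodular matrix.\<close>

definition covolume :: "(real^'n) set \<Rightarrow> real" where
  "covolume \<Lambda> = measure lebesgue (fundamental_parallelepiped (SOME B. lattice_basis B \<Lambda>))"

section \<open>Multigraphs\<close>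

text \<open>Undirected multigraphs; an edge with a single end is a loop.\<close>

record ('a, 'e) multigraph =
  mverts :: "'a set"
  medges :: "'e set"
  mends :: "'e \<Rightarrow> 'a set"

definition multigraph_iso ::
  "('a, 'e) multigraph \<Rightarrow> ('b, 'f) multigraph \<Rightarrow> ('a \<Rightarrow> 'b) \<Rightarrow> ('e \<Rightarrow> 'f) \<Rightarrow> bool" where
  "multigraph_iso G H \<phi> \<psi> \<longleftrightarrow>
     bij_betw \<phi> (mverts G) (mverts H) \<and> bij_betw \<psi> (medges G) (medges H) \<and>
     (\<forall>e\<in>medges G. mends H (\<psi> e) = \<phi> ` mends G e)"

datatype D1D2_vertex = vA | vB | vC | vD

datatype D1D2_edge = e1 | e2 | e3 | e4 | e5 | e6

fun D1D2_ends :: "D1D2_edge \<Rightarrow> D1D2_vertex set" where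
  "D1D2_ends e1 = {vA, vB}"
| "D1D2_ends e2 = {vA, vB}"
| "D1D2_ends e3 = {vC, vD}"
| "D1D2_ends e4 = {vC, vD}"
| "D1D2_ends e5 = {vA, vC}"
| "D1D2_ends e6 = {vB, vD}"

definition D1D2 :: "(D1D2_vertex, D1D2_edge) multigraph" where
  "D1D2 = \<lparr>mverts = UNIV, medges = UNIV, mends = D1D2_ends\<rparr>"

section \<open>Periodic networks\<close>

text \<open>A network is an abstract simple graph together with a map to \<open>\<real>\<^sup>n\<close>. As the map is only
  an immersion, distinct vertices may have the same position and edges may cross; the lattice
  therefore acts on the abstract graph, by automorphisms covering the translations of \<open>\<real>\<^sup>n\<close>.\<close>

record ('v, 'n) network =
  verts :: "'v set"
  edges :: "'v set set"
  pos :: "'v \<Rightarrow> real^'n"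
  lat :: "(real^'n) set"
  act :: "real^'n \<Rightarrow> 'v \<Rightarrow> 'v"

definition vertex_orbit :: "('v, 'n::finite) network \<Rightarrow> 'v \<Rightarrow> 'v set" where
  "vertex_orbit N v = (\<lambda>l. act N l v) ` lat N"

definition edge_orbit :: "('v, 'n::finite) network \<Rightarrow> 'v set \<Rightarrow> 'v set set" where
  "edge_orbit N e = (\<lambda>l. act N l ` e) ` lat N"

definition quotient_graph :: "('v, 'n::finite) network \<Rightarrow> ('v set, 'v set set) multigraph" where
  "quotient_graph N =
     \<lparr>mverts = vertex_orbit N ` verts N,
      medges = edge_orbit N ` edges N,
      mends = (\<lambda>\<epsilon>. vertex_orbit N ` \<Union>\<epsilon>)\<rparr>"

definition simple_graph :: "'v set \<Rightarrow> 'v set set \<Rightarrow> bool" where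
  "simple_graph V E \<longleftrightarrow> (\<forall>e\<in>E. e \<subseteq> V \<and> card e = 2)"

definition connected_graph :: "'v set \<Rightarrow> 'v set set \<Rightarrow> bool" where
  "connected_graph V E \<longleftrightarrow> V \<noteq> {} \<and> (\<forall>v\<in>V. \<forall>w\<in>V. (v, w) \<in> {(a, b). {a, b} \<in> E}\<^sup>*)"

text \<open>Two edges at \<open>v\<close> share only \<open>v\<close> in the graph, so injectivity of the map on
  the union of the edges at \<open>v\<close> (each mapped affinely onto a segment of positive length) means
  that the images of distinct edges meet only in the image of \<open>v\<close>.\<close>

definition immersed :: "'v set set \<Rightarrow> ('v \<Rightarrow> real^'n) \<Rightarrow> bool" where
  "immersed E p \<longleftrightarrow>
     (\<forall>v w. {v, w} \<in> E \<longrightarrow> p v \<noteq> p w) \<and>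
     (\<forall>v w w'. {v, w} \<in> E \<longrightarrow> {v, w'} \<in> E \<longrightarrow> w \<noteq> w' \<longrightarrow>
        closed_segment (p v) (p w) \<inter> closed_segment (p v) (p w') = {p v})"

definition lattice_invariant :: "('v, 'n::finite) network \<Rightarrow> bool" where
  "lattice_invariant N \<longleftrightarrow>
     (\<forall>v\<in>verts N. act N 0 v = v) \<and>
     (\<forall>l\<in>lat N. \<forall>m\<in>lat N. \<forall>v\<in>verts N. act N (l + m) v = act N l (act N m v)) \<and>
     (\<forall>l\<in>lat N. \<forall>v\<in>verts N. act N l v \<in> verts N) \<and>
     (\<forall>l\<in>lat N. \<forall>e\<in>edges N. act N l ` e \<in> edges N) \<and>
     (\<forall>l\<in>lat N. \<forall>v\<in>verts N. pos N (act N l v) = pos N v + l)"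

definition periodic_network :: "('v, 'n::finite) network \<Rightarrow> bool" where
  "periodic_network N \<longleftrightarrow>
     simple_graph (verts N) (edges N) \<and>
     connected_graph (verts N) (edges N) \<and>
     immersed (edges N) (pos N) \<and>
     full_rank_lattice (lat N) \<and>
     lattice_invariant N \<and>
     finite (mverts (quotient_graph N)) \<and> finite (medges (quotient_graph N))"

definition steiner_network :: "('v, 'n::finite) network \<Rightarrow> bool" where
  "steiner_network N \<longleftrightarrow>
     periodic_network N \<and>
     (\<forall>v\<in>verts N. card {e \<in> edges N. v \<in> e} = 3 \<and>
        (\<Sum>w | {v, w} \<in> edges N. sgn (pos N w - pos N v)) = 0)"

text \<open>All edges in one orbit have the same length, as they are translates of each other.\<close>

definition quotient_edge_length :: "('v, 'n::finite) network \<Rightarrow> 'v set set \<Rightarrow> real" where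
  "quotient_edge_length N \<epsilon> = (THE d. \<exists>v w. {v, w} \<in> \<epsilon> \<and> d = dist (pos N v) (pos N w))"

definition network_length :: "('v, 'n::finite) network \<Rightarrow> real" where
  "network_length N = (\<Sum>\<epsilon>\<in>medges (quotient_graph N). quotient_edge_length N \<epsilon>)"

definition spanned_volume :: "('v, 'n::finite) network \<Rightarrow> real" where
  "spanned_volume N = covolume (lat N)"

section \<open>The angle of a network with quotient \<open>D\<^sub>1 \<box> D\<^sub>2\<close>\<close>

definition vector_angle :: "real^'n \<Rightarrow> real^'n \<Rightarrow> real" where
  "vector_angle u v = arccos (u \<bullet> v / (norm u * norm v))"

definition orthogonal_component :: "real^'n \<Rightarrow> real^'n \<Rightarrow> real^'n" where
  "orthogonal_component d u = u - ((u \<bullet> d) / (d \<bullet> d)) *\<^sub>R d"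

text \<open>Here \<open>\<phi>\<close> and \<open>\<psi>\<close> identify the vertices and edges of \<open>D\<^sub>1 \<box> D\<^sub>2\<close> with orbits of \<open>N\<close>, so
  a lift is an element of the corresponding orbit. Since the ends of each edge of \<open>D\<^sub>1 \<box> D\<^sub>2\<close>
  are distinct, \<open>a1\<close> determines the other three lifts, and all choices of \<open>a1\<close> are
  translates of each other; hence there is exactly one such \<open>\<alpha>\<close>.\<close>

definition D1D2_angle ::
  "('v, 'n::finite) network \<Rightarrow> (D1D2_vertex \<Rightarrow> 'v set) \<Rightarrow> (D1D2_edge \<Rightarrow> 'v set set) \<Rightarrow> real" where
  "D1D2_angle N \<phi> \<psi> = (THE \<alpha>. \<exists>a0 a1 a2 a3.
      a1 \<in> \<phi> vA \<and> a2 \<in> \<phi> vC \<and> a0 \<in> \<phi> vB \<and> a3 \<in> \<phi> vD \<and>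
      {a1, a2} \<in> \<psi> e5 \<and> {a1, a0} \<in> \<psi> e1 \<and> {a2, a3} \<in> \<psi> e3 \<and>
      \<alpha> = vector_angle
            (orthogonal_component (pos N a2 - pos N a1) (pos N a1 - pos N a0))
            (orthogonal_component (pos N a2 - pos N a1) (pos N a3 - pos N a2)))"

end

theory Submission
  imports Defs
begin

text \<open>At both ends of the edge over \<open>e5\<close>, balancing forces the other two edges into a plane containing
  its direction \<open>w\<close>, and the edge over \<open>e6\<close> has direction \<open>- w\<close>. So the network is
  determined by the lengths \<open>x\<^sub>i\<close> and by unit vectors \<open>n, m\<close> orthogonal to \<open>w\<close> that span
  the two planes. The lattice is generated by the displacements along three independent
  cycles of \<open>D\<^sub>1 \<box> D\<^sub>2\<close>, and their determinant gives
  \<open>V = 3/4 sin \<alpha> ((x\<^sub>3 + x\<^sub>4) x\<^sub>1 x\<^sub>2 + (x\<^sub>1 + x\<^sub>2) x\<^sub>3 x\<^sub>4 + (x\<^sub>1 + x\<^sub>2) (x\<^sub>3 + x\<^sub>4) (x\<^sub>5 + x\<^sub>6))\<close>.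
  What remains is an inequality of AM-GM type for the \<open>x\<^sub>i\<close>.\<close>

section \<open>Integer spans and covolume\<close>

lemma int_span_zero: "0 \<in> int_span B"
  unfolding int_span_def by (auto intro!: exI[of _ "\<lambda>_. 0"])

lemma int_span_add:
  assumes "x \<in> int_span B" "y \<in> int_span B"
  shows "x + y \<in> int_span B"
proof -
  obtain k l where "x = (\<Sum>b\<in>B. of_int (k b) *\<^sub>R b)" "y = (\<Sum>b\<in>B. of_int (l b) *\<^sub>R b)"
    using assms unfolding int_span_def by blast
  then have "x + y = (\<Sum>b\<in>B. of_int (k b + l b) *\<^sub>R b)"
    by (simp add: scaleR_add_left sum.distrib)
  then show ?thesis
    unfolding int_span_def by (intro CollectI exI[of _ "\<lambda>b. k b + l b"] conjI TrueI)
qed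

lemma int_span_scale:
  assumes "x \<in> int_span B"
  shows "of_int m *\<^sub>R x \<in> int_span B"
proof -
  obtain k where "x = (\<Sum>b\<in>B. of_int (k b) *\<^sub>R b)"
    using assms unfolding int_span_def by blast
  then have "of_int m *\<^sub>R x = (\<Sum>b\<in>B. of_int (m * k b) *\<^sub>R b)"
    by (simp add: scaleR_sum_right)
  then show ?thesis
    unfolding int_span_def by (intro CollectI exI[of _ "\<lambda>b. m * k b"] conjI TrueI)
qed

lemma int_span_uminus: "x \<in> int_span B \<Longrightarrow> - x \<in> int_span B"
  using int_span_scale[of x B "- 1"] by simp

text \<open>The generators form a list and not a set, so they may coincide or be dependent. The
  cycle displacements can thus be handled before they are known to form a basis.\<close>

definition int_combs :: "real^'n \<Rightarrow> real^'n \<Rightarrow> real^'n \<Rightarrow> (real^'n) set" where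
  "int_combs a b c = {of_int i *\<^sub>R a + of_int j *\<^sub>R b + of_int k *\<^sub>R c | i j k. True}"

lemma int_combsI: "of_int i *\<^sub>R a + of_int j *\<^sub>R b + of_int k *\<^sub>R c \<in> int_combs a b c"
  unfolding int_combs_def by blast

lemma int_span_three:
  assumes "a \<noteq> b" "a \<noteq> c" "b \<noteq> c"
  shows "int_span {a, b, c} = int_combs a b c"
proof
  show "int_span {a, b, c} \<subseteq> int_combs a b c"
    using assms by (auto simp: int_span_def int_combs_def add.assoc)
  show "int_combs a b c \<subseteq> int_span {a, b, c}"
  proof
    fix x assume "x \<in> int_combs a b c"
    then obtain i j k where x: "x = of_int i *\<^sub>R a + of_int j *\<^sub>R b + of_int k *\<^sub>R c"
      unfolding int_combs_def by blast
    have "x = (\<Sum>v\<in>{a, b, c}. of_int (if v = a then i else if v = b then j else k) *\<^sub>R v)"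
      using assms by (auto simp: x add.assoc)
    then show "x \<in> int_span {a, b, c}"
      unfolding int_span_def by (intro CollectI exI conjI) auto
  qed
qed

section \<open>Determinants, the volume of a parallelepiped, and the covolume\<close>

lemma det_vector_linear_comb:
  fixes a b c :: "real^3"
  shows "det (vector [p1 *\<^sub>R a + q1 *\<^sub>R b + r1 *\<^sub>R c, p2 *\<^sub>R a + q2 *\<^sub>R b + r2 *\<^sub>R c,
      p3 *\<^sub>R a + q3 *\<^sub>R b + r3 *\<^sub>R c] :: real^3^3) =
    (p1 * (q2 * r3 - r2 * q3) - q1 * (p2 * r3 - r2 * p3) + r1 * (p2 * q3 - q2 * p3)) *
      det (vector [a, b, c] :: real^3^3)"
  by (simp add: det_3 algebra_simps)

text \<open>The half-open cube lies between the open and the closed cube, which differ by a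
  negligible frontier.\<close>

lemma measure_half_open_unit_cube_3:
  "{t :: real^3. \<forall>i. 0 \<le> t $ i \<and> t $ i < 1} \<in> lmeasurable"
  "measure lebesgue {t :: real^3. \<forall>i. 0 \<le> t $ i \<and> t $ i < 1} = 1"
proof -
  let ?S = "{t :: real^3. \<forall>i. 0 \<le> t $ i \<and> t $ i < 1}"
  have 1: "box 0 (1 :: real^3) \<subseteq> ?S" "?S \<subseteq> cbox 0 1"
    by (auto simp: mem_box_cart less_imp_le)
  have "(cbox 0 1 - ?S) \<union> (?S - cbox 0 1) \<subseteq> cbox 0 (1 :: real^3) - box 0 1"
    using 1 by blast
  then have neg: "negligible ((cbox 0 1 - ?S) \<union> (?S - cbox 0 1))"
    using negligible_frontier_interval negligible_subset by blast
  show "?S \<in> lmeasurable"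
    using lmeasurable_negligible_symdiff[OF lmeasurable_cbox neg] by simp
  have "measure lebesgue ?S = measure lebesgue (cbox 0 (1 :: real^3))"
    using measure_negligible_symdiff[OF lmeasurable_cbox neg] by simp
  also have "\<dots> = 1"
    by (simp add: content_cbox_cart interval_ne_empty_cart)
  finally show "measure lebesgue ?S = 1" .
qed

text \<open>The parallelepiped is the image of the half-open unit cube under the linear map with
  columns \<open>a\<close>, \<open>b\<close>, \<open>c\<close>. Distinctness lets coefficients
  indexed by the elements of the set be read as three coordinates.\<close>

lemma measure_fundamental_parallelepiped:
  fixes a b c :: "real^3"
  assumes "a \<noteq> b" "a \<noteq> c" "b \<noteq> c"
  shows "measure lebesgue (fundamental_parallelepiped {a, b, c}) =
    \<bar>det (vector [a, b, c] :: real^3^3)\<bar>"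
proof -
  let ?M = "vector [a, b, c] :: real^3^3"
  let ?f = "\<lambda>t :: real^3. transpose ?M *v t"
  have f: "?f t = t $ 1 *\<^sub>R a + t $ 2 *\<^sub>R b + t $ 3 *\<^sub>R c" for t
    by (simp add: vec_eq_iff matrix_vector_mult_def transpose_def sum_3 mult.commute)
  have "fundamental_parallelepiped {a, b, c} = ?f ` {t. \<forall>i. 0 \<le> t $ i \<and> t $ i < 1}"
  proof (intro equalityI subsetI)
    fix x assume "x \<in> fundamental_parallelepiped {a, b, c}"
    then obtain t where t: "\<forall>v\<in>{a, b, c}. 0 \<le> t v \<and> t v < 1" and
      x: "x = (\<Sum>v\<in>{a, b, c}. t v *\<^sub>R v)"
      unfolding fundamental_parallelepiped_def by blast
    have "x = ?f (vector [t a, t b, t c])"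
      unfolding x f using assms by (simp add: add.assoc)
    then show "x \<in> ?f ` {t. \<forall>i. 0 \<le> t $ i \<and> t $ i < 1}"
      using t by (intro image_eqI) (auto simp: forall_3)
  next
    fix x assume "x \<in> ?f ` {t. \<forall>i. 0 \<le> t $ i \<and> t $ i < 1}"
    then obtain t where t: "\<forall>i. 0 \<le> t $ i \<and> t $ i < 1" and x: "x = ?f t"
      by blast
    let ?s = "\<lambda>v. if v = a then t $ 1 else if v = b then t $ 2 else t $ 3"
    have "x = (\<Sum>v\<in>{a, b, c}. ?s v *\<^sub>R v)"
      unfolding x f using assms by (auto simp: add.assoc)
    moreover have "\<forall>v\<in>{a, b, c}. 0 \<le> ?s v \<and> ?s v < 1"
      using t by auto
    ultimately show "x \<in> fundamental_parallelepiped {a, b, c}"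
      unfolding fundamental_parallelepiped_def by (intro CollectI exI[of _ ?s] conjI)
  qed
  moreover have "measure lebesgue (?f ` {t. \<forall>i. 0 \<le> t $ i \<and> t $ i < 1}) =
      \<bar>det (matrix ?f)\<bar> * measure lebesgue {t :: real^3. \<forall>i. 0 \<le> t $ i \<and> t $ i < 1}"
    by (intro measure_linear_image matrix_vector_mul_linear measure_half_open_unit_cube_3)
  ultimately show ?thesis
    unfolding matrix_of_matrix_vector_mul det_transpose measure_half_open_unit_cube_3 by simp
qed

text \<open>The factor is the determinant of the integer matrix that expresses the new vectors by
  the old ones.\<close>

lemma int_combs_det:
  fixes a b c a' b' c' :: "real^3"
  assumes "a' \<in> int_combs a b c" "b' \<in> int_combs a b c" "c' \<in> int_combs a b c"
  obtains k :: int where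
    "det (vector [a', b', c'] :: real^3^3) = of_int k * det (vector [a, b, c] :: real^3^3)"
proof -
  obtain p1 q1 r1 p2 q2 r2 p3 q3 r3 where
    "a' = of_int p1 *\<^sub>R a + of_int q1 *\<^sub>R b + of_int r1 *\<^sub>R c"
    "b' = of_int p2 *\<^sub>R a + of_int q2 *\<^sub>R b + of_int r2 *\<^sub>R c"
    "c' = of_int p3 *\<^sub>R a + of_int q3 *\<^sub>R b + of_int r3 *\<^sub>R c"
    using assms unfolding int_combs_def by blast
  then have "det (vector [a', b', c'] :: real^3^3) =
    of_int (p1 * (q2 * r3 - r2 * q3) - q1 * (p2 * r3 - r2 * p3) + r1 * (p2 * q3 - q2 * p3)) *
      det (vector [a, b, c] :: real^3^3)"
    by (simp only: det_vector_linear_comb of_int_add of_int_diff of_int_mult)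
  then show ?thesis using that by blast
qed

lemma int_combs_generators:
  "a \<in> int_combs a b c" "b \<in> int_combs a b c" "c \<in> int_combs a b c"
  using int_combsI[of 1 a 0 b 0 c] int_combsI[of 0 a 1 b 0 c] int_combsI[of 0 a 0 b 1 c]
  by simp_all

lemma int_combs_add:
  assumes "x \<in> int_combs a b c" "y \<in> int_combs a b c"
  shows "x + y \<in> int_combs a b c"
proof -
  obtain i j k i' j' k' where "x = of_int i *\<^sub>R a + of_int j *\<^sub>R b + of_int k *\<^sub>R c"
    "y = of_int i' *\<^sub>R a + of_int j' *\<^sub>R b + of_int k' *\<^sub>R c"
    using assms unfolding int_combs_def by blast
  then have "x + y = of_int (i + i') *\<^sub>R a + of_int (j + j') *\<^sub>R b + of_int (k + k') *\<^sub>R c"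
    by (simp add: scaleR_add_left)
  then show ?thesis by (metis int_combsI)
qed

lemma int_combs_uminus:
  assumes "x \<in> int_combs a b c"
  shows "- x \<in> int_combs a b c"
proof -
  obtain i j k where "x = of_int i *\<^sub>R a + of_int j *\<^sub>R b + of_int k *\<^sub>R c"
    using assms unfolding int_combs_def by blast
  then have "- x = of_int (- i) *\<^sub>R a + of_int (- j) *\<^sub>R b + of_int (- k) *\<^sub>R c"
    by simp
  then show ?thesis by (metis int_combsI)
qed

lemma int_combs_zero: "0 \<in> int_combs a b c"
  using int_combsI[of 0 a 0 b 0 c] by simp

text \<open>The basis chosen by \<open>SOME\<close> and the vectors \<open>a\<close>,
  \<open>b\<close>, \<open>c\<close> generate the same group, so each determinant is an integer
  multiple of the other and they agree up to sign. Independence of \<open>a\<close>,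
  \<open>b\<close>, \<open>c\<close> is a conclusion here: it follows from the full rank of the
  lattice.\<close>

lemma covolume_int_combs:
  fixes a b c :: "real^3"
  assumes "full_rank_lattice (int_combs a b c)"
  shows "covolume (int_combs a b c) = \<bar>det (vector [a, b, c] :: real^3^3)\<bar>"
    and "det (vector [a, b, c] :: real^3^3) \<noteq> 0"
proof -
  let ?B = "SOME B. lattice_basis B (int_combs a b c)"
  have B: "lattice_basis ?B (int_combs a b c)"
    using assms unfolding full_rank_lattice_def by (rule someI_ex)
  then have ind: "independent ?B" and span: "span ?B = UNIV"
    and lat: "int_combs a b c = int_span ?B"
    by (auto simp: lattice_basis_def)
  have "card ?B = 3"
    using dim_eq_card[of ?B UNIV] ind span by simp
  then obtain p q r where pqr: "?B = {p, q, r}" "p \<noteq> q" "p \<noteq> r" "q \<noteq> r"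
    by (metis card_3_iff)
  have lat': "int_combs a b c = int_combs p q r"
    using lat pqr by (simp add: int_span_three)
  obtain k where k: "det (vector [p, q, r] :: real^3^3) = of_int k * det (vector [a, b, c] :: real^3^3)"
    using int_combs_det int_combs_generators lat' by metis
  obtain l where l: "det (vector [a, b, c] :: real^3^3) = of_int l * det (vector [p, q, r] :: real^3^3)"
    using int_combs_det int_combs_generators lat' by metis
  \<comment> \<open>The rows of this matrix span the space, which makes it invertible.\<close>
  have "rows (vector [p, q, r] :: real^3^3) = range (($) (vector [p, q, r] :: real^3^3))"
    by (auto simp: rows_def row_def vec_lambda_eta)
  then have "rows (vector [p, q, r] :: real^3^3) = {p, q, r}"
    by (simp add: UNIV_3)
  then have "det (vector [p, q, r] :: real^3^3) \<noteq> 0"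
    using span pqr(1) by (simp add: matrix_left_invertible_span_rows flip: invertible_det_nz
        add: invertible_left_inverse)
  with k l show nz: "det (vector [a, b, c] :: real^3^3) \<noteq> 0"
    by auto
  have "of_int (k * l) * det (vector [a, b, c] :: real^3^3) = det (vector [a, b, c] :: real^3^3)"
    using k l by (simp add: mult.commute mult.left_commute)
  then have "k * l = 1"
    using nz by (simp flip: of_int_mult)
  then have "\<bar>k\<bar> = 1"
    using zmult_eq_1_iff by fastforce
  then have "\<bar>det (vector [p, q, r] :: real^3^3)\<bar> = \<bar>det (vector [a, b, c] :: real^3^3)\<bar>"
    by (simp add: k abs_mult flip: of_int_abs)
  then show "covolume (int_combs a b c) = \<bar>det (vector [a, b, c] :: real^3^3)\<bar>"
    unfolding covolume_def using pqr by (simp add: measure_fundamental_parallelepiped)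
qed

section \<open>Lifts of the edges of \<open>D\<^sub>1 \<box> D\<^sub>2\<close>\<close>

locale periodic =
  fixes N :: "('v, 'n::finite) network"
  assumes periodic: "periodic_network N"
begin

lemma lat_zero: "0 \<in> lat N"
  and lat_add: "\<lbrakk>l \<in> lat N; m \<in> lat N\<rbrakk> \<Longrightarrow> l + m \<in> lat N"
  and lat_uminus: "l \<in> lat N \<Longrightarrow> - l \<in> lat N"
  and lat_scale: "l \<in> lat N \<Longrightarrow> of_int k *\<^sub>R l \<in> lat N"
  using periodic
  by (auto simp: periodic_network_def full_rank_lattice_def lattice_basis_def
      int_span_zero int_span_add int_span_uminus int_span_scale)

lemma act_zero: "v \<in> verts N \<Longrightarrow> act N 0 v = v"
  and act_add: "\<lbrakk>l \<in> lat N; m \<in> lat N; v \<in> verts N\<rbrakk> \<Longrightarrow> act N (l + m) v = act N l (act N m v)"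
  and act_verts: "\<lbrakk>l \<in> lat N; v \<in> verts N\<rbrakk> \<Longrightarrow> act N l v \<in> verts N"
  and act_edges: "\<lbrakk>l \<in> lat N; e \<in> edges N\<rbrakk> \<Longrightarrow> act N l ` e \<in> edges N"
  and pos_act: "\<lbrakk>l \<in> lat N; v \<in> verts N\<rbrakk> \<Longrightarrow> pos N (act N l v) = pos N v + l"
  using periodic by (auto simp: periodic_network_def lattice_invariant_def)

lemma act_uminus_act: "\<lbrakk>l \<in> lat N; v \<in> verts N\<rbrakk> \<Longrightarrow> act N (- l) (act N l v) = v"
  using act_add[of "- l" l v] lat_uminus by (simp add: act_zero)

lemma edge_verts: "\<lbrakk>e \<in> edges N; v \<in> e\<rbrakk> \<Longrightarrow> v \<in> verts N"
  and edge_card: "e \<in> edges N \<Longrightarrow> card e = 2"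
  using periodic by (auto simp: periodic_network_def simple_graph_def)

lemma edge_pair_verts: "{v, w} \<in> edges N \<Longrightarrow> v \<in> verts N" "{v, w} \<in> edges N \<Longrightarrow> w \<in> verts N"
  by (auto intro: edge_verts)

lemma pos_edge_neq: "{v, w} \<in> edges N \<Longrightarrow> pos N v \<noteq> pos N w"
  using periodic by (auto simp: periodic_network_def immersed_def)

lemma vertex_orbit_self: "v \<in> verts N \<Longrightarrow> v \<in> vertex_orbit N v"
  unfolding vertex_orbit_def using lat_zero act_zero by (force intro!: image_eqI[of _ _ 0])

lemma vertex_orbit_act:
  assumes "l \<in> lat N" "v \<in> verts N"
  shows "vertex_orbit N (act N l v) = vertex_orbit N v"
proof -
  \<comment> \<open>One inclusion for all translates suffices; the reverse one is its instance for
    \<open>- l\<close> and \<open>act N l v\<close>.\<close>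
  have sub: "vertex_orbit N (act N m u) \<subseteq> vertex_orbit N u" if "m \<in> lat N" "u \<in> verts N" for m u
    using that by (auto simp: vertex_orbit_def lat_add simp flip: act_add)
  show ?thesis
    using sub[of l v] sub[of "- l" "act N l v"] assms
    by (simp add: act_verts lat_uminus act_uminus_act)
qed

lemma edge_orbit_self: "e \<in> edges N \<Longrightarrow> e \<in> edge_orbit N e"
proof -
  assume "e \<in> edges N"
  then have "act N 0 ` e = e"
    by (auto simp: edge_verts act_zero intro: rev_image_eqI)
  then show ?thesis
    unfolding edge_orbit_def using lat_zero by (force intro!: image_eqI[of _ _ 0])
qed

lemma edge_orbit_act:
  assumes "l \<in> lat N" "e \<in> edges N"
  shows "edge_orbit N (act N l ` e) = edge_orbit N e"
proof -
  have sub: "edge_orbit N (act N m ` f) \<subseteq> edge_orbit N f" if "m \<in> lat N" "f \<in> edges N" for m f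
  proof
    fix g assume "g \<in> edge_orbit N (act N m ` f)"
    then obtain k where k: "k \<in> lat N" and g: "g = act N k ` act N m ` f"
      unfolding edge_orbit_def by blast
    have "g = act N (k + m) ` f"
      unfolding g image_image using that k by (intro image_cong) (auto simp: act_add edge_verts)
    then show "g \<in> edge_orbit N f"
      unfolding edge_orbit_def using k that lat_add by blast
  qed
  have "act N (- l) ` act N l ` e = e"
    unfolding image_image using assms
    by (auto simp: edge_verts act_uminus_act intro: rev_image_eqI)
  then show ?thesis
    using sub[of l e] sub[of "- l" "act N l ` e"] assms by (simp add: act_edges lat_uminus)
qed

end

section \<open>Incidences and orientation of \<open>D1D2\<close>\<close>

lemma D1D2_edge_all: "(\<forall>E. P E) \<longleftrightarrow> P e1 \<and> P e2 \<and> P e3 \<and> P e4 \<and> P e5 \<and> P e6"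
  by (metis D1D2_edge.exhaust)

lemma UNIV_D1D2_edge: "UNIV = {e1, e2, e3, e4, e5, e6}"
  unfolding set_eq_iff D1D2_edge_all by simp

lemma D1D2_incident:
  "{E. vA \<in> D1D2_ends E} = {e1, e2, e5}"
  "{E. vB \<in> D1D2_ends E} = {e1, e2, e6}"
  "{E. vC \<in> D1D2_ends E} = {e3, e4, e5}"
  "{E. vD \<in> D1D2_ends E} = {e3, e4, e6}"
  unfolding set_eq_iff D1D2_edge_all by simp_all

text \<open>An arbitrary orientation, fixed so that each edge has one displacement vector with a
  definite sign.\<close>

fun tail head :: "D1D2_edge \<Rightarrow> D1D2_vertex" where
  "tail e1 = vA" | "tail e2 = vA" | "tail e3 = vC" | "tail e4 = vC" | "tail e5 = vA" | "tail e6 = vB"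
| "head e1 = vB" | "head e2 = vB" | "head e3 = vD" | "head e4 = vD" | "head e5 = vC" | "head e6 = vD"

lemma D1D2_ends_tail_head: "D1D2_ends E = {tail E, head E}"
  and tail_neq_head: "tail E \<noteq> head E"
  by (cases E; simp)+

section \<open>Vertices and edges of \<open>N\<close> as lifts\<close>

locale D1D2_network = periodic N for N :: "('v, 'n::finite) network" +
  fixes \<phi> :: "D1D2_vertex \<Rightarrow> 'v set"
    and \<psi> :: "D1D2_edge \<Rightarrow> 'v set set"
  assumes steiner: "steiner_network N"
    and iso: "multigraph_iso D1D2 (quotient_graph N) \<phi> \<psi>"
begin

lemma phi_bij: "bij_betw \<phi> UNIV (vertex_orbit N ` verts N)"
  and psi_bij: "bij_betw \<psi> UNIV (edge_orbit N ` edges N)"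
  and ends: "vertex_orbit N ` \<Union>(\<psi> E) = \<phi> ` D1D2_ends E"
  using iso by (auto simp: multigraph_iso_def D1D2_def quotient_graph_def)

text \<open>Orbits that meet are equal, so membership becomes an equation between orbits, to which
  the bijectivity of \<open>\<phi>\<close> applies.\<close>

lemma phi_orbit: "v \<in> \<phi> X \<longleftrightarrow> v \<in> verts N \<and> \<phi> X = vertex_orbit N v"
proof
  assume v: "v \<in> \<phi> X"
  obtain u where u: "u \<in> verts N" "\<phi> X = vertex_orbit N u"
    using bij_betw_apply[OF phi_bij, of X] by auto
  then obtain l where "l \<in> lat N" "v = act N l u"
    using v by (auto simp: vertex_orbit_def)
  then show "v \<in> verts N \<and> \<phi> X = vertex_orbit N v"
    using u by (simp add: act_verts vertex_orbit_act)
qed (auto simp: vertex_orbit_self)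

lemma psi_orbit: "e \<in> \<psi> E \<longleftrightarrow> e \<in> edges N \<and> \<psi> E = edge_orbit N e"
proof
  assume e: "e \<in> \<psi> E"
  obtain f where f: "f \<in> edges N" "\<psi> E = edge_orbit N f"
    using bij_betw_apply[OF psi_bij, of E] by auto
  then obtain l where "l \<in> lat N" "e = act N l ` f"
    using e by (auto simp: edge_orbit_def)
  then show "e \<in> edges N \<and> \<psi> E = edge_orbit N e"
    using f by (simp add: act_edges edge_orbit_act)
qed (auto simp: edge_orbit_self)

lemma phi_eqD: "v \<in> \<phi> X \<Longrightarrow> v \<in> \<phi> Y \<Longrightarrow> X = Y"
  using phi_bij by (metis phi_orbit bij_betw_imp_inj_on injD)

lemma psi_eqD: "e \<in> \<psi> E \<Longrightarrow> e \<in> \<psi> F \<Longrightarrow> E = F"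
  using psi_bij by (metis psi_orbit bij_betw_imp_inj_on injD)

lemma edges_psi: "e \<in> edges N \<Longrightarrow> \<exists>E. e \<in> \<psi> E"
  using psi_bij by (metis psi_orbit bij_betw_imp_surj_on image_iff)

lemma phi_nonempty: "\<exists>v. v \<in> \<phi> X"
  using phi_bij phi_orbit by (metis bij_betw_imp_surj_on image_iff rangeI)

lemma psi_nonempty: "\<exists>e. e \<in> \<psi> E"
  using psi_bij psi_orbit by (metis bij_betw_imp_surj_on image_iff rangeI)

lemma phi_act: "l \<in> lat N \<Longrightarrow> v \<in> \<phi> X \<Longrightarrow> act N l v \<in> \<phi> X"
  by (metis phi_orbit act_verts vertex_orbit_act)

lemma psi_act: "l \<in> lat N \<Longrightarrow> {v, w} \<in> \<psi> E \<Longrightarrow> {act N l v, act N l w} \<in> \<psi> E"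
  using act_edges[of l "{v, w}"] edge_orbit_act[of l "{v, w}"] psi_orbit by (metis image_empty image_insert)

lemma phi_act_obtain:
  assumes "v \<in> \<phi> X" "w \<in> \<phi> X"
  obtains l where "l \<in> lat N" "w = act N l v"
  using assms phi_orbit[of v X] by (auto simp: vertex_orbit_def)

lemma phi_pos_diff: "v \<in> \<phi> X \<Longrightarrow> w \<in> \<phi> X \<Longrightarrow> pos N w - pos N v \<in> lat N"
  by (metis phi_act_obtain phi_orbit pos_act add_diff_cancel_left')

text \<open>The quotient reads the ends of an edge off the union of its whole orbit. All edges in
  the orbit are translates, so a single one already shows the same ends.\<close>

lemma psi_ends:
  assumes "e \<in> \<psi> E"
  shows "vertex_orbit N ` e = \<phi> ` D1D2_ends E"
proof -
  have "vertex_orbit N ` f = vertex_orbit N ` e" if f: "f \<in> \<psi> E" for f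
  proof -
    obtain l where l: "l \<in> lat N" "f = act N l ` e"
      using assms psi_orbit[of e E] f by (auto simp: edge_orbit_def)
    then show ?thesis
      unfolding l image_image using assms psi_orbit[of e E]
      by (intro image_cong) (auto simp: vertex_orbit_act edge_verts)
  qed
  then have "vertex_orbit N ` \<Union>(\<psi> E) = vertex_orbit N ` e"
    using assms by blast
  then show ?thesis using ends by simp
qed

lemma psi_end_phi:
  assumes "{v, w} \<in> \<psi> E" "v \<in> \<phi> X" "D1D2_ends E = {X, Y}"
  shows "w \<in> \<phi> Y"
proof -
  have vw: "v \<in> verts N" "w \<in> verts N" "v \<noteq> w"
    using assms(1) psi_orbit edge_pair_verts edge_card[of "{v, w}"] by (auto simp: card_2_iff')
  have "{vertex_orbit N v, vertex_orbit N w} = {\<phi> X, \<phi> Y}"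
    using psi_ends[OF assms(1)] assms(3) by simp
  then have "vertex_orbit N w = \<phi> Y"
    using assms(2) phi_orbit by (metis doubleton_eq_iff)
  then show ?thesis
    using vw phi_orbit by simp
qed

lemma psi_endE:
  assumes "{v, w} \<in> \<psi> E"
  obtains X where "v \<in> \<phi> X" "X \<in> D1D2_ends E"
proof -
  have "vertex_orbit N v \<in> \<phi> ` D1D2_ends E"
    using psi_ends[OF assms] by auto
  moreover have "v \<in> verts N"
    using assms psi_orbit edge_pair_verts by blast
  ultimately show ?thesis
    using that phi_orbit by auto
qed

text \<open>Some lift of \<open>E\<close> has an end over \<open>X\<close>; a lattice element moves
  that end to \<open>v\<close>.\<close>

lemma exists_neighbour:
  assumes "v \<in> \<phi> X" "X \<in> D1D2_ends E"
  shows "\<exists>w. {v, w} \<in> \<psi> E"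
proof -
  obtain e where e: "e \<in> \<psi> E" using psi_nonempty by blast
  have "\<phi> X \<in> vertex_orbit N ` e" using psi_ends[OF e] assms by auto
  then obtain p where p: "p \<in> e" "vertex_orbit N p = \<phi> X" by auto
  have "card e = 2" "p \<in> verts N" using e p psi_orbit[of e E] by (auto simp: edge_card edge_verts)
  then obtain q where q: "e = {p, q}"
    using p by (auto simp: card_2_iff)
  have "p \<in> \<phi> X" using p \<open>p \<in> verts N\<close> phi_orbit by simp
  then obtain l where "l \<in> lat N" "v = act N l p"
    using phi_act_obtain assms(1) by blast
  then show ?thesis using psi_act e q by blast
qed

lemma card_incident: "card {E. X \<in> D1D2_ends E} = 3"
  by (cases X) (simp_all add: D1D2_incident)

text \<open>The quotient map is a local bijection on stars. Lifts of different edges are different,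
  since edge orbits are disjoint, and both \<open>v\<close> and \<open>X\<close> have degree 3, so
  the chosen lifts exhaust the star of \<open>v\<close>.\<close>

lemma star_bij:
  assumes v: "v \<in> \<phi> X" and w: "\<And>E. X \<in> D1D2_ends E \<Longrightarrow> {v, w E} \<in> \<psi> E"
  shows "bij_betw w {E. X \<in> D1D2_ends E} {u. {v, u} \<in> edges N}"
proof -
  let ?S = "{E. X \<in> D1D2_ends E}"
  let ?T = "{e \<in> edges N. v \<in> e}"
  have inj: "inj_on (\<lambda>E. {v, w E}) ?S"
  proof (rule inj_onI)
    fix E F assume "E \<in> ?S" "F \<in> ?S" "{v, w E} = {v, w F}"
    then show "E = F" using w psi_eqD by (metis mem_Collect_eq)
  qed
  have sub: "(\<lambda>E. {v, w E}) ` ?S \<subseteq> ?T"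
    using w psi_orbit by auto
  have T: "card ?T = 3"
    using steiner v phi_orbit by (auto simp: steiner_network_def)
  then have "finite ?T" by (simp add: card_ge_0_finite)
  then have eq: "(\<lambda>E. {v, w E}) ` ?S = ?T"
    using sub inj T card_incident by (intro card_subset_eq) (auto simp: card_image)
  have neq: "u \<noteq> v" if "{v, u} \<in> edges N" for u
    using pos_edge_neq that by blast
  show ?thesis
    unfolding bij_betw_def
  proof
    show "inj_on w ?S" using inj by (auto simp: inj_on_def)
    show "w ` ?S = {u. {v, u} \<in> edges N}"
    proof (intro equalityI subsetI)
      fix u assume "u \<in> {u. {v, u} \<in> edges N}"
      then have "{v, u} \<in> ?T" "u \<noteq> v" using neq by auto
      then obtain E where "E \<in> ?S" "{v, u} = {v, w E}" using eq by (metis (no_types, lifting) imageE)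
      then show "u \<in> w ` ?S" using \<open>u \<noteq> v\<close> by (auto simp: doubleton_eq_iff)
    qed (use w psi_orbit in auto)
  qed
qed

text \<open>Every edge at \<open>v\<close> is one of the chosen lifts, and disjointness of the edge
  orbits tells which one.\<close>

lemma neighbour_unique:
  assumes "{v, p} \<in> \<psi> E" "{v, q} \<in> \<psi> E"
  shows "p = q"
proof -
  obtain X where X: "v \<in> \<phi> X" "X \<in> D1D2_ends E" using psi_endE assms(1) by blast
  obtain w where w: "\<And>E. X \<in> D1D2_ends E \<Longrightarrow> {v, w E} \<in> \<psi> E"
    using exists_neighbour[OF X(1)] by metis
  have *: "u = w E" if u: "{v, u} \<in> \<psi> E" for u
  proof -
    have "u \<in> w ` {E. X \<in> D1D2_ends E}"
      using star_bij[OF X(1) w] u psi_orbit by (auto simp: bij_betw_def)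
    then obtain F where "X \<in> D1D2_ends F" "u = w F" by auto
    moreover have "F = E" using calculation w u psi_eqD by blast
    ultimately show ?thesis by simp
  qed
  show ?thesis using *[OF assms(1)] *[OF assms(2)] by simp
qed

lemma balanced:
  assumes v: "v \<in> \<phi> X" and w: "\<And>E. X \<in> D1D2_ends E \<Longrightarrow> {v, w E} \<in> \<psi> E"
  shows "(\<Sum>E | X \<in> D1D2_ends E. sgn (pos N (w E) - pos N v)) = 0"
proof -
  have "(\<Sum>E | X \<in> D1D2_ends E. sgn (pos N (w E) - pos N v)) =
      (\<Sum>u | {v, u} \<in> edges N. sgn (pos N u - pos N v))"
    using sum.reindex_bij_betw[OF star_bij[OF assms], of "\<lambda>u. sgn (pos N u - pos N v)"] by simp
  also have "\<dots> = 0"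
    using steiner v phi_orbit by (auto simp: steiner_network_def)
  finally show ?thesis .
qed

text \<open>The lattice element that takes \<open>v\<close> to \<open>v'\<close> takes
  \<open>w\<close> to \<open>w'\<close>, by uniqueness of lifts, and it acts on positions as a
  translation.\<close>

lemma edge_displacement_unique:
  assumes "v \<in> \<phi> X" "v' \<in> \<phi> X" "{v, w} \<in> \<psi> E" "{v', w'} \<in> \<psi> E"
  shows "pos N w' - pos N v' = pos N w - pos N v"
proof -
  obtain l where l: "l \<in> lat N" "v' = act N l v"
    using phi_act_obtain assms(1,2) by blast
  then have "w' = act N l w"
    using psi_act[OF l(1) assms(3)] assms(4) neighbour_unique by blast
  moreover have "v \<in> verts N" "w \<in> verts N"
    using assms(3) psi_orbit edge_pair_verts by blast+
  ultimately show ?thesis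
    using l by (simp add: pos_act)
qed

text \<open>Starting at a lift of the tail fixes the sign; all such lifts are translates, so the
  description has exactly one value.\<close>

definition edge_vector :: "D1D2_edge \<Rightarrow> real^'n" where
  "edge_vector E = (THE y. \<exists>v w. v \<in> \<phi> (tail E) \<and> {v, w} \<in> \<psi> E \<and> y = pos N w - pos N v)"

lemma tail_displacement:
  assumes "v \<in> \<phi> (tail E)" "{v, w} \<in> \<psi> E"
  shows "pos N w - pos N v = edge_vector E"
  unfolding edge_vector_def using assms edge_displacement_unique
  by (intro the_equality[symmetric]) blast+

lemma head_displacement:
  assumes "v \<in> \<phi> (head E)" "{v, w} \<in> \<psi> E"
  shows "pos N w - pos N v = - edge_vector E"
proof -
  have "w \<in> \<phi> (tail E)"
    using psi_end_phi[OF assms(2,1)] D1D2_ends_tail_head by (metis insert_commute)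
  then have "pos N v - pos N w = edge_vector E"
    using assms(2) by (intro tail_displacement) (simp_all add: insert_commute)
  then show ?thesis by (metis minus_diff_eq)
qed

lemma lift_edge: obtains v w where "v \<in> \<phi> (tail E)" "w \<in> \<phi> (head E)" "{v, w} \<in> \<psi> E"
  using phi_nonempty exists_neighbour psi_end_phi D1D2_ends_tail_head by (metis insertI1)

lemma edge_vector_nonzero: "edge_vector E \<noteq> 0"
proof -
  obtain v w where vw: "v \<in> \<phi> (tail E)" "w \<in> \<phi> (head E)" "{v, w} \<in> \<psi> E"
    by (rule lift_edge)
  then show ?thesis
    using tail_displacement[OF vw(1,3)] pos_edge_neq[of v w] psi_orbit by auto
qed

lemma edge_length: "quotient_edge_length N (\<psi> E) = norm (edge_vector E)"
  unfolding quotient_edge_length_def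
proof (rule the_equality)
  obtain v w where vw: "v \<in> \<phi> (tail E)" "w \<in> \<phi> (head E)" "{v, w} \<in> \<psi> E"
    by (rule lift_edge)
  then show "\<exists>v w. {v, w} \<in> \<psi> E \<and> norm (edge_vector E) = dist (pos N v) (pos N w)"
    using tail_displacement[OF vw(1,3)] by (metis dist_norm dist_commute)
next
  fix d assume "\<exists>v w. {v, w} \<in> \<psi> E \<and> d = dist (pos N v) (pos N w)"
  then obtain v w where vw: "{v, w} \<in> \<psi> E" and d: "d = norm (pos N w - pos N v)"
    by (metis dist_norm dist_commute)
  obtain X where "v \<in> \<phi> X" "X \<in> {tail E, head E}"
    using psi_endE[OF vw] D1D2_ends_tail_head by metis
  then show "d = norm (edge_vector E)"
    unfolding d using vw tail_displacement head_displacement by fastforce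
qed

lemma length_sum: "network_length N = (\<Sum>E\<in>UNIV. norm (edge_vector E))"
  unfolding network_length_def quotient_graph_def
  by (simp add: edge_length flip: sum.reindex_bij_betw[OF psi_bij])

lemma balanced_edge_vectors:
  "(\<Sum>E | X \<in> D1D2_ends E. if X = tail E then sgn (edge_vector E) else - sgn (edge_vector E)) = 0"
proof -
  obtain v where v: "v \<in> \<phi> X" using phi_nonempty by blast
  obtain w where w: "\<And>E. X \<in> D1D2_ends E \<Longrightarrow> {v, w E} \<in> \<psi> E"
    using exists_neighbour[OF v] by metis
  have "sgn (pos N (w E) - pos N v) =
      (if X = tail E then sgn (edge_vector E) else - sgn (edge_vector E))"
    if "X \<in> D1D2_ends E" for E
  proof -
    have "X = tail E \<or> X = head E" using that by (auto simp: D1D2_ends_tail_head)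
    then show ?thesis
      using tail_displacement[of v E "w E"] head_displacement[of v E "w E"] v w[OF that]
      by (auto simp: sgn_minus tail_neq_head tail_neq_head[symmetric])
  qed
  then show ?thesis
    using balanced[OF v w] by simp
qed

text \<open>In the signed sums over all four vertices each edge occurs once with either sign and
  cancels, so these three equations carry the full information.\<close>

lemma balanced_AB: "sgn (edge_vector e1) + sgn (edge_vector e2) + sgn (edge_vector e5) = 0"
    "sgn (edge_vector e6) = sgn (edge_vector e1) + sgn (edge_vector e2)"
  and balanced_C: "sgn (edge_vector e5) = sgn (edge_vector e3) + sgn (edge_vector e4)"
  using balanced_edge_vectors[of vA] balanced_edge_vectors[of vB] balanced_edge_vectors[of vC]
  by (simp_all add: D1D2_incident algebra_simps add_eq_0_iff)

text \<open>All admissible lifts have the same displacements, so the angle is well defined. The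
  minus sign appears because \<open>pos N a1 - pos N a0\<close> runs against the orientation of
  \<open>e1\<close>.\<close>

lemma angle_edge_vectors:
  "D1D2_angle N \<phi> \<psi> = vector_angle
     (orthogonal_component (edge_vector e5) (- edge_vector e1))
     (orthogonal_component (edge_vector e5) (edge_vector e3))"
  unfolding D1D2_angle_def
proof (rule the_equality, goal_cases)
  case 1
  obtain a1 where a1: "a1 \<in> \<phi> vA" using phi_nonempty by blast
  obtain a0 where a0: "{a1, a0} \<in> \<psi> e1" using exists_neighbour[OF a1, of e1] by auto
  obtain a2 where a2: "{a1, a2} \<in> \<psi> e5" using exists_neighbour[OF a1, of e5] by auto
  have b: "a0 \<in> \<phi> vB" "a2 \<in> \<phi> vC"
    using psi_end_phi[OF a0 a1, of vB] psi_end_phi[OF a2 a1, of vC] by simp_all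
  obtain a3 where a3: "{a2, a3} \<in> \<psi> e3" using exists_neighbour[OF b(2), of e3] by auto
  have "a3 \<in> \<phi> vD" using psi_end_phi[OF a3 b(2), of vD] by simp
  moreover have "pos N a2 - pos N a1 = edge_vector e5" "pos N a0 - pos N a1 = edge_vector e1"
    "pos N a3 - pos N a2 = edge_vector e3"
    using a0 a1 a2 a3 b by (simp_all add: tail_displacement)
  ultimately show ?case
    using a0 a1 a2 a3 b by (metis minus_diff_eq)
next
  case (2 \<alpha>)
  then obtain a0 a1 a2 a3 where a: "a1 \<in> \<phi> vA" "a2 \<in> \<phi> vC" "{a1, a2} \<in> \<psi> e5" "{a1, a0} \<in> \<psi> e1"
      "{a2, a3} \<in> \<psi> e3" and \<alpha>: "\<alpha> = vector_angle
        (orthogonal_component (pos N a2 - pos N a1) (pos N a1 - pos N a0))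
        (orthogonal_component (pos N a2 - pos N a1) (pos N a3 - pos N a2))"
    by blast
  have "pos N a2 - pos N a1 = edge_vector e5" "pos N a0 - pos N a1 = edge_vector e1"
    "pos N a3 - pos N a2 = edge_vector e3"
    using a by (simp_all add: tail_displacement)
  then show ?case
    unfolding \<alpha> by (metis minus_diff_eq)
qed

text \<open>Each cycle of the quotient graph lifts to a path whose ends differ by a lattice vector. The
  generators below come from the three edges outside the spanning tree \<open>{e1, e3, e5}\<close>;
  \<open>h\<close> is the displacement from \<open>A\<close> along that tree.\<close>

lemma lat_edge_vectors:
  "lat N = int_combs (edge_vector e1 - edge_vector e2) (edge_vector e3 - edge_vector e4)
     (edge_vector e5 + edge_vector e3 - edge_vector e6 - edge_vector e1)"
    (is "_ = int_combs ?g1 ?g2 ?g3")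
proof -
  define h where "h X = (case X of vA \<Rightarrow> 0 | vB \<Rightarrow> edge_vector e1 | vC \<Rightarrow> edge_vector e5
    | vD \<Rightarrow> edge_vector e5 + edge_vector e3)" for X
  have h: "edge_vector E - (h (head E) - h (tail E)) \<in> int_combs ?g1 ?g2 ?g3" for E
  proof -
    \<comment> \<open>The defect vanishes on the tree edges \<open>e1\<close>, \<open>e3\<close>,
      \<open>e5\<close> and is minus a generator on \<open>e2\<close>, \<open>e4\<close>,
      \<open>e6\<close>.\<close>
    have "edge_vector E - (h (head E) - h (tail E)) \<in> {0, - ?g1, - ?g2, - ?g3}"
      by (cases E) (simp_all add: h_def)
    then show ?thesis
      using int_combs_zero int_combs_generators[THEN int_combs_uminus] by (metis insert_iff empty_iff)
  qed
  obtain a where a: "a \<in> \<phi> vA" using phi_nonempty by blast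
  \<comment> \<open>Along any path from \<open>a\<close>, positions agree with \<open>h\<close>
    modulo the group spanned by the three generators.\<close>
  have reach: "\<exists>X. v \<in> \<phi> X \<and> pos N v - pos N a - h X \<in> int_combs ?g1 ?g2 ?g3"
    if "(a, v) \<in> {(v, w). {v, w} \<in> edges N}\<^sup>*" for v
    using that
  proof (induction rule: rtrancl_induct)
    case base
    then show ?case using a int_combs_zero by (auto intro!: exI[of _ vA] simp: h_def)
  next
    case (step v w)
    then obtain X where X: "v \<in> \<phi> X" and IH: "pos N v - pos N a - h X \<in> int_combs ?g1 ?g2 ?g3"
      by blast
    obtain E where E: "{v, w} \<in> \<psi> E"
      using step edges_psi by blast
    have "X \<in> D1D2_ends E"
      using psi_endE[OF E] X phi_eqD by metis
    then consider "X = tail E" | "X = head E"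
      by (auto simp: D1D2_ends_tail_head)
    then show ?case
    proof cases
      case 1
      have "w \<in> \<phi> (head E)"
        using psi_end_phi[OF E X] 1 D1D2_ends_tail_head by simp
      moreover have "pos N w - pos N a - h (head E) =
          (pos N v - pos N a - h X) + (edge_vector E - (h (head E) - h (tail E)))"
        using tail_displacement[OF _ E] X 1 by (simp add: algebra_simps)
      ultimately show ?thesis
        using int_combs_add[OF IH h[of E]] by metis
    next
      case 2
      have "w \<in> \<phi> (tail E)"
        using psi_end_phi[OF E X] 2 D1D2_ends_tail_head by (simp add: insert_commute)
      moreover have "pos N w - pos N a - h (tail E) =
          (pos N v - pos N a - h X) + - (edge_vector E - (h (head E) - h (tail E)))"
        using head_displacement[OF _ E] X 2 by (simp add: algebra_simps)
      ultimately show ?thesis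
        using int_combs_add[OF IH int_combs_uminus[OF h[of E]]] by metis
    qed
  qed
  show ?thesis
  proof (intro equalityI subsetI)
    fix l assume l: "l \<in> lat N"
    \<comment> \<open>This translate of \<open>a\<close> lies over \<open>vA\<close>, where
      \<open>h\<close> is 0, so \<open>reach\<close> puts the translation \<open>l\<close> itself
      into the group.\<close>
    have "act N l a \<in> \<phi> vA" using l a phi_act by blast
    moreover have "(a, act N l a) \<in> {(v, w). {v, w} \<in> edges N}\<^sup>*"
      using periodic a l phi_orbit act_verts
      by (auto simp: periodic_network_def connected_graph_def)
    ultimately have "pos N (act N l a) - pos N a - h vA \<in> int_combs ?g1 ?g2 ?g3"
      using reach phi_eqD by blast
    then show "l \<in> int_combs ?g1 ?g2 ?g3"
      using pos_act[OF l] a phi_orbit by (auto simp: h_def)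
  next
    obtain b where b: "{a, b} \<in> \<psi> e1" using exists_neighbour[OF a, of e1] by auto
    obtain b' where b': "{a, b'} \<in> \<psi> e2" using exists_neighbour[OF a, of e2] by auto
    obtain c where c: "{a, c} \<in> \<psi> e5" using exists_neighbour[OF a, of e5] by auto
    have B: "b \<in> \<phi> vB" "b' \<in> \<phi> vB" and C: "c \<in> \<phi> vC"
      using psi_end_phi[OF b a, of vB] psi_end_phi[OF b' a, of vB] psi_end_phi[OF c a, of vC] by simp_all
    obtain d where d: "{c, d} \<in> \<psi> e3" using exists_neighbour[OF C, of e3] by auto
    obtain d' where d': "{c, d'} \<in> \<psi> e4" using exists_neighbour[OF C, of e4] by auto
    obtain d'' where d'': "{b, d''} \<in> \<psi> e6" using exists_neighbour[OF B(1), of e6] by auto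
    have D: "d \<in> \<phi> vD" "d' \<in> \<phi> vD" "d'' \<in> \<phi> vD"
      using psi_end_phi[OF d C, of vD] psi_end_phi[OF d' C, of vD] psi_end_phi[OF d'' B(1), of vD] by simp_all
    have disp: "pos N b - pos N a = edge_vector e1" "pos N b' - pos N a = edge_vector e2"
      "pos N c - pos N a = edge_vector e5" "pos N d - pos N c = edge_vector e3"
      "pos N d' - pos N c = edge_vector e4" "pos N d'' - pos N b = edge_vector e6"
      using a b b' c d d' d'' B C by (simp_all add: tail_displacement)
    \<comment> \<open>Each generator is the difference of the positions of two lifts of one
      vertex.\<close>
    have "pos N b - pos N b' = ?g1" "pos N d - pos N d' = ?g2" "pos N d - pos N d'' = ?g3"
      by (simp_all flip: disp)
    then have "?g1 \<in> lat N" "?g2 \<in> lat N" "?g3 \<in> lat N"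
      using phi_pos_diff B D by metis+
    then show "l \<in> lat N" if "l \<in> int_combs ?g1 ?g2 ?g3" for l
      using that lat_add lat_scale unfolding int_combs_def by blast
  qed
qed

end

section \<open>Euclidean geometry of the edge vectors\<close>

text \<open>The norms force \<open>u \<bullet> v = - 1 / 2\<close>, the 120 degree condition. Hence
  \<open>u - v\<close> has norm \<open>sqrt 3\<close> and is orthogonal to
  \<open>u + v\<close>.\<close>

lemma unit_pair_decomposition:
  fixes u v :: "'a::real_inner"
  assumes "norm u = 1" "norm v = 1" "norm (u + v) = 1"
  defines "n \<equiv> (1 / sqrt 3) *\<^sub>R (u - v)"
  shows "norm n = 1" "n \<bullet> (u + v) = 0"
    "u = (1 / 2) *\<^sub>R (u + v) + (sqrt 3 / 2) *\<^sub>R n"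
    "v = (1 / 2) *\<^sub>R (u + v) - (sqrt 3 / 2) *\<^sub>R n"
proof -
  have uv: "u \<bullet> u = 1" "v \<bullet> v = 1" "(u + v) \<bullet> (u + v) = 1"
    using assms by (simp_all add: norm_eq_1)
  then have "u \<bullet> v = - 1 / 2"
    by (simp add: inner_add_left inner_add_right inner_commute)
  then have "n \<bullet> n = 1"
    using uv by (simp add: n_def inner_diff_left inner_diff_right inner_commute)
  then show "norm n = 1" by (simp add: norm_eq_1)
  show "n \<bullet> (u + v) = 0"
    using uv by (simp add: n_def inner_diff_left inner_add_left inner_diff_right inner_add_right inner_commute)
  have n: "(sqrt 3 / 2) *\<^sub>R n = (1 / 2) *\<^sub>R (u - v)"
    by (simp add: n_def)
  show "u = (1 / 2) *\<^sub>R (u + v) + (sqrt 3 / 2) *\<^sub>R n"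
    "v = (1 / 2) *\<^sub>R (u + v) - (sqrt 3 / 2) *\<^sub>R n"
    unfolding n by (simp_all add: algebra_simps flip: scaleR_add_left)
qed

text \<open>The Gram matrix is the product of the matrix with its transpose.\<close>

lemma det_squared_gram:
  fixes a b c :: "real^3"
  shows "(det (vector [a, b, c] :: real^3^3))\<^sup>2 =
    det (vector [vector [a \<bullet> a, a \<bullet> b, a \<bullet> c], vector [b \<bullet> a, b \<bullet> b, b \<bullet> c],
      vector [c \<bullet> a, c \<bullet> b, c \<bullet> c]] :: real^3^3)"
proof -
  let ?M = "vector [a, b, c] :: real^3^3"
  have "(det ?M)\<^sup>2 = det (?M ** transpose ?M)"
    by (simp only: det_mul det_transpose power2_eq_square)
  also have "?M ** transpose ?M = vector [vector [a \<bullet> a, a \<bullet> b, a \<bullet> c], vector [b \<bullet> a, b \<bullet> b, b \<bullet> c],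
      vector [c \<bullet> a, c \<bullet> b, c \<bullet> c]]"
    by (simp add: vec_eq_iff forall_3 matrix_matrix_mult_def transpose_def inner_vec_def)
  finally show ?thesis .
qed

lemma orthogonal_component_decomposed:
  fixes w n :: "real^'n"
  assumes "norm w = 1" "n \<bullet> w = 0" "t \<noteq> 0"
  shows "orthogonal_component (t *\<^sub>R w) (p *\<^sub>R w + q *\<^sub>R n) = q *\<^sub>R n"
  using assms by (simp add: orthogonal_component_def inner_add_left norm_eq_1)

lemma vector_angle_scaled_units:
  fixes n m :: "real^'n"
  assumes "norm n = 1" "norm m = 1" "p > 0" "q > 0"
  shows "vector_angle (- (p *\<^sub>R n)) (q *\<^sub>R m) = arccos (- (n \<bullet> m))"
  using assms by (simp add: vector_angle_def)

text \<open>Balancing at the ends of \<open>e5\<close> and \<open>e6\<close> puts the six edges in two planes containing \<open>w\<close>,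
  the direction of \<open>e5\<close>; these planes have unit directions \<open>n\<close> and \<open>m\<close> orthogonal to \<open>w\<close>.\<close>

lemma D1D2_frame:
  fixes y :: "D1D2_edge \<Rightarrow> real^'n"
  assumes nz: "\<And>E. y E \<noteq> 0"
    and bal: "sgn (y e1) + sgn (y e2) + sgn (y e5) = 0" "sgn (y e6) = sgn (y e1) + sgn (y e2)"
      "sgn (y e5) = sgn (y e3) + sgn (y e4)"
  obtains w n m where "norm w = 1" "norm n = 1" "norm m = 1" "n \<bullet> w = 0" "m \<bullet> w = 0"
    "y e1 = norm (y e1) *\<^sub>R (- (1 / 2) *\<^sub>R w + (sqrt 3 / 2) *\<^sub>R n)"
    "y e2 = norm (y e2) *\<^sub>R (- (1 / 2) *\<^sub>R w - (sqrt 3 / 2) *\<^sub>R n)"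
    "y e3 = norm (y e3) *\<^sub>R ((1 / 2) *\<^sub>R w + (sqrt 3 / 2) *\<^sub>R m)"
    "y e4 = norm (y e4) *\<^sub>R ((1 / 2) *\<^sub>R w - (sqrt 3 / 2) *\<^sub>R m)"
    "y e5 = norm (y e5) *\<^sub>R w" "y e6 = - (norm (y e6) *\<^sub>R w)"
proof -
  define w where "w = sgn (y e5)"
  define n where "n = (1 / sqrt 3) *\<^sub>R (sgn (y e1) - sgn (y e2))"
  define m where "m = (1 / sqrt 3) *\<^sub>R (sgn (y e3) - sgn (y e4))"
  have unit: "norm (sgn (y E)) = 1" for E using nz by (simp add: norm_sgn)
  have y: "y E = norm (y E) *\<^sub>R sgn (y E)" for E by (simp add: sgn_div_norm nz)
  have sum12: "sgn (y e1) + sgn (y e2) = - w" and sum34: "sgn (y e3) + sgn (y e4) = w"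
    and w6: "sgn (y e6) = - w"
    using bal by (simp_all add: w_def add_eq_0_iff2)
  have "norm w = 1" by (simp add: w_def unit)
  then have "norm (sgn (y e1) + sgn (y e2)) = 1" "norm (sgn (y e3) + sgn (y e4)) = 1"
    by (simp_all only: sum12 sum34 norm_minus_cancel)
  \<comment> \<open>The two pairs have sums \<open>- w\<close> and \<open>w\<close>, whence the
    opposite signs of the \<open>w\<close> components in the frame.\<close>
  note 12 = unit_pair_decomposition[OF unit unit this(1), folded n_def, unfolded sum12]
    and 34 = unit_pair_decomposition[OF unit unit this(2), folded m_def, unfolded sum34]
  show thesis
  proof (rule that)
    show "norm w = 1" "norm n = 1" "norm m = 1" "n \<bullet> w = 0" "m \<bullet> w = 0"
      using \<open>norm w = 1\<close> 12(1,2) 34(1,2) by simp_all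
    show "y e5 = norm (y e5) *\<^sub>R w" using y[of e5] by (simp add: w_def)
    show "y e6 = - (norm (y e6) *\<^sub>R w)" using y[of e6] by (simp add: w6)
    show "y e1 = norm (y e1) *\<^sub>R (- (1 / 2) *\<^sub>R w + (sqrt 3 / 2) *\<^sub>R n)"
      using y[of e1] 12(3) by simp
    show "y e2 = norm (y e2) *\<^sub>R (- (1 / 2) *\<^sub>R w - (sqrt 3 / 2) *\<^sub>R n)"
      using y[of e2] 12(4) by simp
    show "y e3 = norm (y e3) *\<^sub>R ((1 / 2) *\<^sub>R w + (sqrt 3 / 2) *\<^sub>R m)"
      using y[of e3] 34(3) by simp
    show "y e4 = norm (y e4) *\<^sub>R ((1 / 2) *\<^sub>R w - (sqrt 3 / 2) *\<^sub>R m)"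
      using y[of e4] 34(4) by simp
  qed
qed

lemma orthogonal_transformation_orthonormal_frame:
  fixes a b c :: "real^3"
  assumes "norm a = 1" "norm b = 1" "norm c = 1" "a \<bullet> b = 0" "a \<bullet> c = 0" "b \<bullet> c = 0"
  shows "orthogonal_transformation (\<lambda>v :: real^3. v $ 1 *\<^sub>R a + v $ 2 *\<^sub>R b + v $ 3 *\<^sub>R c)"
  unfolding orthogonal_transformation_def
proof
  show "linear (\<lambda>v :: real^3. v $ 1 *\<^sub>R a + v $ 2 *\<^sub>R b + v $ 3 *\<^sub>R c)"
    by (intro linearI) (simp_all add: algebra_simps)
  have "b \<bullet> a = 0" "c \<bullet> a = 0" "c \<bullet> b = 0"
    using assms by (simp_all add: inner_commute)
  then have "(p1 *\<^sub>R a + p2 *\<^sub>R b + p3 *\<^sub>R c) \<bullet> (q1 *\<^sub>R a + q2 *\<^sub>R b + q3 *\<^sub>R c) =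
      p1 * q1 + p2 * q2 + p3 * q3" for p1 p2 p3 q1 q2 q3
    using assms by (simp add: inner_add_left inner_add_right norm_eq_1)
  then show "\<forall>v w. (v $ 1 *\<^sub>R a + v $ 2 *\<^sub>R b + v $ 3 *\<^sub>R c) \<bullet>
      (w $ 1 *\<^sub>R a + w $ 2 *\<^sub>R b + w $ 3 *\<^sub>R c) = v \<bullet> (w :: real^3)"
    by (simp add: inner_vec_def[of "_ :: real^3" "_ :: real^3"] sum_3)
qed

lemma int_combs_image:
  assumes "linear f"
  shows "f ` int_combs a b c = int_combs (f a) (f b) (f c)"
proof -
  have "f (of_int i *\<^sub>R a + of_int j *\<^sub>R b + of_int k *\<^sub>R c) =
      of_int i *\<^sub>R f a + of_int j *\<^sub>R f b + of_int k *\<^sub>R f c" for i j k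
    using assms by (simp add: linear_add linear_scale)
  then show ?thesis
    unfolding int_combs_def by (auto simp: image_iff) metis+
qed

lemma int_combs_uminus_left: "int_combs (- a) b c = int_combs a b c"
proof -
  have "int_combs (- x) b c \<subseteq> int_combs x b c" for x
  proof
    fix v assume "v \<in> int_combs (- x) b c"
    then obtain i j k where "v = of_int i *\<^sub>R (- x) + of_int j *\<^sub>R b + of_int k *\<^sub>R c"
      unfolding int_combs_def by blast
    then have "v = of_int (- i) *\<^sub>R x + of_int j *\<^sub>R b + of_int k *\<^sub>R c" by simp
    then show "v \<in> int_combs x b c" by (metis int_combsI)
  qed
  from this[of a] this[of "- a"] show ?thesis by auto
qed

section \<open>The isoperimetric inequality\<close>

text \<open>The deficit is split into the losses from \<open>s < 1\<close>, from unequal \<open>x1, x2\<close>, unequal \<open>x3, x4\<close>,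
  unequal \<open>p, q\<close>, and from \<open>4 (S + r)\<^sup>3 - 243/64 S\<^sup>2 (S + 4 r)\<close> with \<open>S = p + q\<close>, which has the double
  root \<open>S = 8 r\<close>.\<close>

lemma isoperimetric_inequality:
  fixes x1 x2 x3 x4 r s :: real
  assumes pos: "x1 > 0" "x2 > 0" "x3 > 0" "x4 > 0" "r > 0" and s: "0 < s" "s \<le> 1"
  defines "L \<equiv> x1 + x2 + x3 + x4 + r"
    and "V \<equiv> 3/4 * s * ((x3 + x4) * (x1 * x2) + (x1 + x2) * (x3 * x4) + (x1 + x2) * (x3 + x4) * r)"
  shows "L ^ 3 / V \<ge> 81 / 4"
    and "L ^ 3 / V = 81 / 4 \<longleftrightarrow> x1 = x2 \<and> x2 = x3 \<and> x3 = x4 \<and> x4 = 2 * r \<and> s = 1"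
proof -
  define p q where "p = x1 + x2" and "q = x3 + x4"
  define P where "P = q * (x1 * x2) + p * (x3 * x4) + p * q * r"
  have pq: "p > 0" "q > 0" using pos by (auto simp: p_def q_def)
  have "P > 0" unfolding P_def using pos pq by (intro add_pos_pos mult_pos_pos)
  have V: "V = 3/4 * s * P" by (simp add: V_def P_def p_def q_def)
  have "V > 0" using \<open>P > 0\<close> s by (simp add: V)
  have L: "L = p + q + r" by (simp add: L_def p_def q_def)
  \<comment> \<open>Substitute \<open>4 * x1 * x2 = p^2 - (x1 - x2)^2\<close>, the same for
    \<open>x3 * x4\<close>, and \<open>4 * p * q = (p + q)^2 - (p - q)^2\<close> in
    \<open>P\<close>.\<close>
  have deficit: "4 * L ^ 3 - 81 * V = 243/4 * (1 - s) * P
      + 243/16 * q * (x1 - x2)\<^sup>2 + 243/16 * p * (x3 - x4)\<^sup>2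
      + 243/64 * (p - q)\<^sup>2 * (p + q + 4 * r)
      + (8 * r - (p + q))\<^sup>2 * (13 * (p + q) + 4 * r) / 64"
    unfolding V L P_def p_def q_def
    by (simp add: field_simps power2_eq_square power3_eq_cube)
  have nn: "243/4 * (1 - s) * P \<ge> 0" "243/16 * q * (x1 - x2)\<^sup>2 \<ge> 0" "243/16 * p * (x3 - x4)\<^sup>2 \<ge> 0"
    "243/64 * (p - q)\<^sup>2 * (p + q + 4 * r) \<ge> 0"
    "(8 * r - (p + q))\<^sup>2 * (13 * (p + q) + 4 * r) / 64 \<ge> 0"
    using pq \<open>P > 0\<close> s pos by auto
  have "4 * L ^ 3 - 81 * V \<ge> 0"
    unfolding deficit using nn by linarith
  then show "L ^ 3 / V \<ge> 81 / 4"
    using \<open>V > 0\<close> by (simp add: field_simps)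
  have "L ^ 3 / V = 81 / 4 \<longleftrightarrow> 4 * L ^ 3 - 81 * V = 0"
    using \<open>V > 0\<close> by (auto simp: field_simps)
  \<comment> \<open>A sum of nonnegative terms vanishes only if every term does.\<close>
  also have "\<dots> \<longleftrightarrow> 243/4 * (1 - s) * P = 0 \<and> 243/16 * q * (x1 - x2)\<^sup>2 = 0 \<and>
      243/16 * p * (x3 - x4)\<^sup>2 = 0 \<and> 243/64 * (p - q)\<^sup>2 * (p + q + 4 * r) = 0 \<and>
      (8 * r - (p + q))\<^sup>2 * (13 * (p + q) + 4 * r) / 64 = 0"
    unfolding deficit using nn by linarith
  also have "\<dots> \<longleftrightarrow> s = 1 \<and> x1 = x2 \<and> x3 = x4 \<and> p = q \<and> 8 * r = p + q"
    using pq \<open>P > 0\<close> pos by (auto simp: add_pos_pos)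
  also have "\<dots> \<longleftrightarrow> x1 = x2 \<and> x2 = x3 \<and> x3 = x4 \<and> x4 = 2 * r \<and> s = 1"
    by (auto simp: p_def q_def)
  finally show "L ^ 3 / V = 81 / 4 \<longleftrightarrow> x1 = x2 \<and> x2 = x3 \<and> x3 = x4 \<and> x4 = 2 * r \<and> s = 1" .
qed

section \<open>Angle, volume and equality case of the network\<close>

theorem theorem5p4:
  fixes N :: "('v, 3) network"
    and \<phi> :: "D1D2_vertex \<Rightarrow> 'v set"
    and \<psi> :: "D1D2_edge \<Rightarrow> 'v set set"
    and x1 x2 x3 x4 x5 x6 \<alpha> L V :: real
  assumes "steiner_network N"
    and "multigraph_iso D1D2 (quotient_graph N) \<phi> \<psi>"
    and "x1 = quotient_edge_length N (\<psi> e1)"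
    and "x2 = quotient_edge_length N (\<psi> e2)"
    and "x3 = quotient_edge_length N (\<psi> e3)"
    and "x4 = quotient_edge_length N (\<psi> e4)"
    and "x5 = quotient_edge_length N (\<psi> e5)"
    and "x6 = quotient_edge_length N (\<psi> e6)"
    and "\<alpha> = D1D2_angle N \<phi> \<psi>"
    and "L = network_length N"
    and "V = spanned_volume N"
  shows "0 < \<alpha> \<and> \<alpha> < pi \<and>
    L ^ 3 / V \<ge> 81 / 4 \<and>
    (L ^ 3 / V = 81 / 4 \<longleftrightarrow>
       x1 = x2 \<and> x2 = x3 \<and> x3 = x4 \<and> x4 = 2 * x5 + 2 * x6 \<and> \<alpha> = pi / 2) \<and>
    (L ^ 3 / V = 81 / 4 \<longrightarrow>
       (\<exists>(c :: real) (f :: real^3 \<Rightarrow> real^3). 0 < c \<and> orthogonal_transformation f \<and>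
          lat N = (\<lambda>v. c *\<^sub>R f v) `
            int_span {vector [0, 1, 0], vector [0, 0, 1], (1 / 2) *\<^sub>R vector [sqrt 3, 1, 1]}))"
proof -
  interpret D1D2_network N \<phi> \<psi>
    using assms(1,2) by unfold_locales (auto simp: steiner_network_def)
  let ?y = edge_vector
  have x: "x1 = norm (?y e1)" "x2 = norm (?y e2)" "x3 = norm (?y e3)" "x4 = norm (?y e4)"
      "x5 = norm (?y e5)" "x6 = norm (?y e6)"
    using assms(3-8) by (simp_all add: edge_length)
  then have pos: "x1 > 0" "x2 > 0" "x3 > 0" "x4 > 0" "x5 > 0" "x6 > 0"
    by (simp_all add: edge_vector_nonzero)
  have L: "L = x1 + x2 + x3 + x4 + (x5 + x6)"
    unfolding assms(10) length_sum x UNIV_D1D2_edge by simp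
  obtain w n m where norms: "norm w = 1" "norm n = 1" "norm m = 1" and orth: "n \<bullet> w = 0" "m \<bullet> w = 0"
    and y: "?y e1 = x1 *\<^sub>R (- (1 / 2) *\<^sub>R w + (sqrt 3 / 2) *\<^sub>R n)"
      "?y e2 = x2 *\<^sub>R (- (1 / 2) *\<^sub>R w - (sqrt 3 / 2) *\<^sub>R n)"
      "?y e3 = x3 *\<^sub>R ((1 / 2) *\<^sub>R w + (sqrt 3 / 2) *\<^sub>R m)"
      "?y e4 = x4 *\<^sub>R ((1 / 2) *\<^sub>R w - (sqrt 3 / 2) *\<^sub>R m)"
      "?y e5 = x5 *\<^sub>R w" "?y e6 = - (x6 *\<^sub>R w)"
    unfolding x by (rule D1D2_frame[of ?y, OF edge_vector_nonzero balanced_AB balanced_C])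

  \<comment> \<open>The orthogonal components are a negative multiple of \<open>n\<close> and a
    positive multiple of \<open>m\<close>, so the angle is the supplement of the one between
    \<open>n\<close> and \<open>m\<close>.\<close>
  have \<alpha>: "\<alpha> = arccos (- (n \<bullet> m))"
  proof -
    have "- ?y e1 = (x1 / 2) *\<^sub>R w + (- (x1 * sqrt 3 / 2)) *\<^sub>R n"
      "?y e3 = (x3 / 2) *\<^sub>R w + (x3 * sqrt 3 / 2) *\<^sub>R m"
      unfolding y by (simp_all add: algebra_simps)
    then have "orthogonal_component (?y e5) (- ?y e1) = - ((x1 * sqrt 3 / 2) *\<^sub>R n)"
      "orthogonal_component (?y e5) (?y e3) = (x3 * sqrt 3 / 2) *\<^sub>R m"
      using orthogonal_component_decomposed[OF norms(1) orth(1), of x5]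
        orthogonal_component_decomposed[OF norms(1) orth(2), of x5] pos y(5)
      by (metis less_irrefl scaleR_minus_left)+
    then have "\<alpha> = vector_angle (- ((x1 * sqrt 3 / 2) *\<^sub>R n)) ((x3 * sqrt 3 / 2) *\<^sub>R m)"
      by (simp add: assms(9) angle_edge_vectors)
    then show ?thesis
      using norms pos by (simp add: vector_angle_scaled_units)
  qed

  define g1 g2 g3 where "g1 = ?y e1 - ?y e2" and "g2 = ?y e3 - ?y e4"
    and "g3 = ?y e5 + ?y e3 - ?y e6 - ?y e1"
  \<comment> \<open>Here \<open>s\<close> is the sine of 120 degrees; the variable \<open>s\<close>
    of \<open>isoperimetric_inequality\<close> will be \<open>sin \<alpha>\<close>.\<close>
  define s where "s = sqrt 3 / 2"
  have lat: "lat N = int_combs g1 g2 g3"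
    unfolding lat_edge_vectors g1_def g2_def g3_def ..
  have full: "full_rank_lattice (int_combs g1 g2 g3)"
    using periodic by (simp add: periodic_network_def flip: lat)
  have g: "g1 = (- (x1 - x2) / 2) *\<^sub>R w + (s * (x1 + x2)) *\<^sub>R n + 0 *\<^sub>R m"
    "g2 = ((x3 - x4) / 2) *\<^sub>R w + 0 *\<^sub>R n + (s * (x3 + x4)) *\<^sub>R m"
    "g3 = (x5 + x6 + (x1 + x3) / 2) *\<^sub>R w + (- (s * x1)) *\<^sub>R n + (s * x3) *\<^sub>R m"
    unfolding g1_def g2_def g3_def y s_def[symmetric]
    by (simp_all add: algebra_simps add_divide_distrib diff_divide_distrib)
  define P where "P = (x3 + x4) * (x1 * x2) + (x1 + x2) * (x3 * x4) + (x1 + x2) * (x3 + x4) * (x5 + x6)"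
  have "P > 0"
    unfolding P_def using pos by (intro add_pos_pos mult_pos_pos)
  have "det (vector [g1, g2, g3] :: real^3^3) = s\<^sup>2 * P * det (vector [w, n, m] :: real^3^3)"
    unfolding g det_vector_linear_comb P_def by (simp add: field_simps power2_eq_square)
  then have det_g: "det (vector [g1, g2, g3] :: real^3^3) = 3/4 * P * det (vector [w, n, m] :: real^3^3)"
    by (simp add: s_def power_divide)
  have det_wnm: "(det (vector [w, n, m] :: real^3^3))\<^sup>2 = 1 - (n \<bullet> m)\<^sup>2"
    unfolding det_squared_gram using norms orth
    by (simp add: det_3 inner_commute norm_eq_1 power2_eq_square)
  \<comment> \<open>Full rank of the lattice keeps the two planes from being parallel, which places
    \<alpha> strictly between 0 and \<open>pi\<close>.\<close>
  have "det (vector [w, n, m] :: real^3^3) \<noteq> 0"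
    using covolume_int_combs(2)[OF full] det_g by auto
  then have "(n \<bullet> m)\<^sup>2 < 1"
    using det_wnm by (metis diff_gt_0_iff_gt zero_less_power2)
  then have nm: "\<bar>n \<bullet> m\<bar> < 1"
    by (simp add: abs_square_less_1)
  have \<alpha>_bounds: "0 < \<alpha>" "\<alpha> < pi"
    using nm arccos_lt_bounded[of "- (n \<bullet> m)"] by (auto simp: \<alpha>)
  have sin_\<alpha>: "sin \<alpha> = \<bar>det (vector [w, n, m] :: real^3^3)\<bar>"
    using nm by (simp add: \<alpha> sin_arccos flip: det_wnm)
  have V: "V = 3/4 * sin \<alpha> * P"
    unfolding assms(11) spanned_volume_def lat covolume_int_combs(1)[OF full] det_g sin_\<alpha>
    using \<open>P > 0\<close> by (simp add: abs_mult)
  have sin_1: "sin \<alpha> = 1 \<longleftrightarrow> \<alpha> = pi / 2"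
  proof
    assume "sin \<alpha> = 1"
    then have "cos \<alpha> = 0" using sin_cos_squared_add[of \<alpha>] by simp
    then show "\<alpha> = pi / 2" using \<alpha>_bounds cos_inj_pi[of \<alpha> "pi / 2"] by simp
  qed (simp only: sin_pi_half)
  have "0 < sin \<alpha>"
    using \<alpha>_bounds by (rule sin_gt_zero)
  moreover have "0 < x5 + x6"
    using pos by simp
  \<comment> \<open>The inequality is used with \<open>r = x5 + x6\<close> and
    \<open>s = sin \<alpha>\<close>.\<close>
  ultimately have iso: "L ^ 3 / V \<ge> 81 / 4"
    "L ^ 3 / V = 81 / 4 \<longleftrightarrow> x1 = x2 \<and> x2 = x3 \<and> x3 = x4 \<and> x4 = 2 * (x5 + x6) \<and> sin \<alpha> = 1"
    using isoperimetric_inequality[OF pos(1-4)] unfolding V L P_def by (blast intro: sin_le_one)+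
  have equality: "L ^ 3 / V = 81 / 4 \<longleftrightarrow>
       x1 = x2 \<and> x2 = x3 \<and> x3 = x4 \<and> x4 = 2 * x5 + 2 * x6 \<and> \<alpha> = pi / 2"
    using iso(2) sin_1 by simp
  have "\<exists>(c :: real) (f :: real^3 \<Rightarrow> real^3). 0 < c \<and> orthogonal_transformation f \<and>
      lat N = (\<lambda>v. c *\<^sub>R f v) `
        int_span {vector [0, 1, 0], vector [0, 0, 1], (1 / 2) *\<^sub>R vector [sqrt 3, 1, 1]}"
    if "L ^ 3 / V = 81 / 4"
  proof -
    have eq: "x2 = x1" "x3 = x1" "x4 = x1" "x5 + x6 = x1 / 2" "\<alpha> = pi / 2"
      using that equality by auto
    have "- (n \<bullet> m) = cos \<alpha>" using nm by (simp add: \<alpha> cos_arccos_abs)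
    then have "n \<bullet> m = 0" by (simp add: eq)
    \<comment> \<open>The second axis goes to \<open>- n\<close> because \<open>g3\<close> has a
      negative component along \<open>n\<close>, while all coordinates of the third model generator
      are positive.\<close>
    define f where "f v = v $ 1 *\<^sub>R w + v $ 2 *\<^sub>R (- n) + v $ 3 *\<^sub>R m" for v :: "real^3"
    \<comment> \<open>The common length of \<open>g1\<close> and \<open>g2\<close> in the equality
      case.\<close>
    define c where "c = sqrt 3 * x1"
    let ?a = "vector [0, 1, 0] :: real^3" and ?b = "vector [0, 0, 1] :: real^3"
      and ?d = "(1 / 2) *\<^sub>R vector [sqrt 3, 1, 1] :: real^3"
    have f: "orthogonal_transformation f"
      unfolding f_def using norms orth \<open>n \<bullet> m = 0\<close>
      by (intro orthogonal_transformation_orthonormal_frame) (simp_all add: inner_commute)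
    have "linear (\<lambda>v. c *\<^sub>R f v)"
      using orthogonal_transformation_linear[OF f] by (rule linear_compose_scale_right)
    moreover have "c *\<^sub>R f ?a = - g1" "c *\<^sub>R f ?b = g2"
      unfolding g by (simp_all add: f_def c_def s_def eq)
    moreover have "c *\<^sub>R f ?d = g3"
    proof -
      have "c *\<^sub>R f ?d = (c * sqrt 3 / 2) *\<^sub>R w + (- (c / 2)) *\<^sub>R n + (c / 2) *\<^sub>R m"
        by (simp add: f_def scaleR_right_distrib scaleR_right_diff_distrib)
      also have "\<dots> = g3"
        unfolding g by (simp add: c_def s_def eq)
      finally show ?thesis .
    qed
    moreover have "?a \<noteq> ?b" "?a \<noteq> ?d" "?b \<noteq> ?d"
      by (simp_all add: vec_eq_iff forall_3)
    ultimately have "lat N = (\<lambda>v. c *\<^sub>R f v) ` int_span {?a, ?b, ?d}"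
      by (simp add: lat int_span_three int_combs_image int_combs_uminus_left)
    moreover have "0 < c" using pos by (simp add: c_def)
    ultimately show ?thesis using f by blast
  qed
  then show ?thesis
    using \<alpha>_bounds iso(1) equality by blast
qed

end
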